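(* Let $S$ be a finite monoid such that its set of idempotents $E(S)$ is a subsemigroup of $S$. Then $S$ can be embedded (as a semigroup) in a finite monoid $T$ such that $E(T)$ is a submonoid of $T$ and $T$ is generated as a semigroup by a set of two generators $\{\alpha,\beta\}$, where $\beta$ is a group element and $\alpha$ is nilpotent of index $2$. Moreover, if $|E(S)|\geq 2$, then $T$ can be taken so that in addition $E(T)$ satisfies the same semigroup identities as $E(S)$.
   Context: $E(S)$ denotes the set of idempotents of a semigroup $S$. An embedding is an injective semigroup homomorphism (it need not send the identity of $S$ to the identity of $T$). A group element of a semigroup is an element lying in some subgroup of that semigroup. An element $\alpha$ of a semigroup with zero $0$ is nilpotent of index $2$ if $\alpha\neq 0$ and $\alpha^2=0$. A semigroup identity is a formal equality $p=q$ of two nonempty words in variables; a semigroup satisfies it if equality holds under every substitution of elements of the semigroup for the variables. "Satisfies the same semigroup identities" means that, for every semigroup identity $p=q$, $E(T)$ satisfies $p=q$ if and only if $E(S)$ does. *)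

theory Defs
  imports "HOL-Algebra.Group"
begin

text \<open>
  Semigroup-theoretic notions for the records of HOL-Algebra.  The field \<open>one\<close> plays no role in
  them: \<open>group_element\<close> overrides it, because the identity of a subgroup of a semigroup need not
  be the identity of the ambient monoid.
\<close>

definition idempotents :: "('a, 'b) monoid_scheme \<Rightarrow> 'a set"
  where "idempotents G = {x \<in> carrier G. x \<otimes>\<^bsub>G\<^esub> x = x}"

definition subsemigroup :: "'a set \<Rightarrow> ('a, 'b) monoid_scheme \<Rightarrow> bool"
  where "subsemigroup H G \<longleftrightarrow>
    H \<noteq> {} \<and> H \<subseteq> carrier G \<and> (\<forall>x\<in>H. \<forall>y\<in>H. x \<otimes>\<^bsub>G\<^esub> y \<in> H)"

definition group_element :: "('a, 'b) monoid_scheme \<Rightarrow> 'a \<Rightarrow> bool"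
  where "group_element G x \<longleftrightarrow>
    (\<exists>H e. H \<subseteq> carrier G \<and> x \<in> H \<and> group (G\<lparr>carrier := H, one := e\<rparr>))"

definition is_zero :: "('a, 'b) monoid_scheme \<Rightarrow> 'a \<Rightarrow> bool"
  where "is_zero G z \<longleftrightarrow>
    z \<in> carrier G \<and> (\<forall>x\<in>carrier G. z \<otimes>\<^bsub>G\<^esub> x = z \<and> x \<otimes>\<^bsub>G\<^esub> z = z)"

definition nilpotent_index2 :: "('a, 'b) monoid_scheme \<Rightarrow> 'a \<Rightarrow> bool"
  where "nilpotent_index2 G x \<longleftrightarrow>
    x \<in> carrier G \<and> (\<exists>z. is_zero G z \<and> x \<noteq> z \<and> x \<otimes>\<^bsub>G\<^esub> x = z)"

inductive_set semigroup_generate :: "('a, 'b) monoid_scheme \<Rightarrow> 'a set \<Rightarrow> 'a set"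
  for G and A
where
  incl: "x \<in> A \<Longrightarrow> x \<in> semigroup_generate G A"
| mult: "x \<in> semigroup_generate G A \<Longrightarrow> y \<in> semigroup_generate G A
    \<Longrightarrow> x \<otimes>\<^bsub>G\<^esub> y \<in> semigroup_generate G A"

text \<open>
  Words are nonempty lists of variables \<open>0, 1, 2, \<dots>\<close>; the value of the empty list is irrelevant.
\<close>

fun word_value :: "('a, 'b) monoid_scheme \<Rightarrow> (nat \<Rightarrow> 'a) \<Rightarrow> nat list \<Rightarrow> 'a"
where
  "word_value G s [] = undefined"
| "word_value G s [v] = s v"
| "word_value G s (v # w # ws) = s v \<otimes>\<^bsub>G\<^esub> word_value G s (w # ws)"

definition satisfies_identity :: "('a, 'b) monoid_scheme \<Rightarrow> nat list \<Rightarrow> nat list \<Rightarrow> bool"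
  where "satisfies_identity G p q \<longleftrightarrow>
    (\<forall>s. (\<forall>v. s v \<in> carrier G) \<longrightarrow> word_value G s p = word_value G s q)"

definition same_identities :: "('a, 'b) monoid_scheme \<Rightarrow> ('c, 'd) monoid_scheme \<Rightarrow> bool"
  where "same_identities G H \<longleftrightarrow>
    (\<forall>p q. p \<noteq> [] \<longrightarrow> q \<noteq> [] \<longrightarrow> satisfies_identity G p q = satisfies_identity H p q)"

definition embeds_in :: "('a, 'b) monoid_scheme \<Rightarrow> ('c, 'd) monoid_scheme \<Rightarrow> bool"
  where "embeds_in G H \<longleftrightarrow> (\<exists>f \<in> hom G H. inj_on f (carrier G))"

definition generated_by_nilpotent_and_group_element :: "('a, 'b) monoid_scheme \<Rightarrow> bool"
  where "generated_by_nilpotent_and_group_element G \<longleftrightarrow>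
    (\<exists>\<alpha> \<beta>. \<alpha> \<in> carrier G \<and> \<beta> \<in> carrier G \<and> \<alpha> \<noteq> \<beta> \<and>
      semigroup_generate G {\<alpha>, \<beta>} = carrier G \<and>
      group_element G \<beta> \<and> nilpotent_index2 G \<alpha>)"

end

theory Submission
  imports Defs
begin

text \<open>
  Let \<open>S\<close> have \<open>m\<close> elements, put \<open>n = m\<^sup>2 + 1\<close>, and consider \<open>n \<times> n\<close> matrices over \<open>S\<close> with a zero
  adjoined that have at most one nonzero entry in each row and in each column.  An idempotent one
  is diagonal with idempotent entries, so the idempotents form a subband of a power of \<open>E(S)\<close> with
  a zero adjoined.  An identity of the monoid \<open>E(S)\<close> has the same variables on both
  sides unless \<open>E(S)\<close> is trivial, and then adjoining a zero preserves it.

  Let \<open>\<beta>\<close> be the matrix of the cyclic shift and let \<open>\<alpha>\<close> have the entry \<open>s\<^sub>k\<close> at \<open>(k, m(k + 1))\<close> for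
  \<open>k < m\<close>, where \<open>S = {s\<^sub>0, \<dots>}\<close> and \<open>s\<^sub>0 = 1\<close>.  Then \<open>\<alpha>\<^sup>2 = 0\<close>.  All differences between a
  nonzero row and a nonzero column of \<open>\<alpha>\<close> are distinct modulo \<open>n\<close>, so every \<open>\<alpha> \<beta>\<^sup>b \<alpha>\<close> has at
  most one nonzero entry; choosing \<open>b\<close> suitably and shifting rows and columns by powers of \<open>\<beta>\<close>
  yields every matrix with a single nonzero entry, at \<open>(0, 0)\<close>.
\<close>

section \<open>Words and identities\<close>

lemma word_value_carrier_update [simp]: "word_value (G\<lparr>carrier := H\<rparr>) s w = word_value G s w"
  by (induction G s w rule: word_value.induct) auto

lemma word_value_closed:
  assumes "\<And>x y. x \<in> carrier G \<Longrightarrow> y \<in> carrier G \<Longrightarrow> x \<otimes>\<^bsub>G\<^esub> y \<in> carrier G"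
    and "\<And>v. s v \<in> carrier G" and "w \<noteq> []"
  shows "word_value G s w \<in> carrier G"
  using assms by (induction G s w rule: word_value.induct) auto

lemma word_value_hom:
  assumes "\<And>x y. x \<in> carrier G \<Longrightarrow> y \<in> carrier G \<Longrightarrow> x \<otimes>\<^bsub>G\<^esub> y \<in> carrier G"
    and "h \<in> hom G H" and "\<And>v. s v \<in> carrier G" and "w \<noteq> []"
  shows "h (word_value G s w) = word_value H (\<lambda>v. h (s v)) w"
  using assms(3,4)
proof (induction w rule: induct_list012)
  case (3 v u ws)
  then show ?case
    using word_value_closed[OF assms(1), of s "u # ws"] hom_mult[OF assms(2)] by auto
qed auto

text \<open>Identities are inherited along embeddings: \<open>h\<close> carries the two word values
  to equal elements, and injectivity reflects the equality. Only closure of \<open>G\<close> is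
  assumed, so the lemma applies to sets of idempotents.\<close>

lemma satisfies_identity_embedding:
  assumes closed: "\<And>x y. x \<in> carrier G \<Longrightarrow> y \<in> carrier G \<Longrightarrow> x \<otimes>\<^bsub>G\<^esub> y \<in> carrier G"
    and h: "h \<in> hom G H" and inj: "inj_on h (carrier G)"
    and "p \<noteq> []" and "q \<noteq> []" and sat: "satisfies_identity H p q"
  shows "satisfies_identity G p q"
  unfolding satisfies_identity_def
proof (intro allI impI)
  fix s :: "nat \<Rightarrow> _" assume s: "\<forall>v. s v \<in> carrier G"
  have "\<forall>v. h (s v) \<in> carrier H"
    using s hom_in_carrier[OF h] by blast
  then have "word_value H (\<lambda>v. h (s v)) p = word_value H (\<lambda>v. h (s v)) q"
    using sat by (simp add: satisfies_identity_def)
  moreover have "h (word_value G s w) = word_value H (\<lambda>v. h (s v)) w" if "w \<noteq> []" for w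
    by (rule word_value_hom[OF closed h]) (use s that in auto)
  moreover have "word_value G s w \<in> carrier G" if "w \<noteq> []" for w
    by (rule word_value_closed[OF closed]) (use s that in auto)
  ultimately show "word_value G s p = word_value G s q"
    using inj \<open>p \<noteq> []\<close> \<open>q \<noteq> []\<close> by (simp add: inj_onD)
qed

text \<open>Put \<open>e\<close> for one variable \<open>x\<close> and the identity for all others:
  a word then takes the value \<open>e\<close> if \<open>x\<close> occurs in it, and the identity
  otherwise.\<close>

lemma same_content_if_satisfies_identity:
  fixes S (structure)
  assumes S: "monoid S" and sat: "satisfies_identity (S\<lparr>carrier := idempotents S\<rparr>) p q"
    and e: "e \<in> idempotents S" "e \<noteq> \<one>\<^bsub>S\<^esub>" and "p \<noteq> []" "q \<noteq> []"
  shows "set p = set q"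
proof -
  interpret monoid S by fact
  have val: "word_value S (\<lambda>v. if v = x then e else \<one>) w = (if x \<in> set w then e else \<one>)"
    if "w \<noteq> []" for w x
    using that e(1) by (induction w rule: induct_list012) (auto simp: idempotents_def)
  have "x \<in> set p \<longleftrightarrow> x \<in> set q" for x
  proof -
    have "\<forall>v. (if v = x then e else \<one>) \<in> idempotents S"
      using e(1) by (auto simp: idempotents_def)
    then have "word_value S (\<lambda>v. if v = x then e else \<one>) p
        = word_value S (\<lambda>v. if v = x then e else \<one>) q"
      using sat by (simp add: satisfies_identity_def)
    then show ?thesis
      using val assms(5,6) e(2) by (auto split: if_splits)
  qed
  then show ?thesis by blast
qed

section \<open>Transport along isomorphisms\<close>

text \<open>Serves to replace a monoid of matrices by a copy on natural numbers. Membership in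
  \<open>iso\<close> says nothing about the field \<open>one\<close> of \<open>N\<close>, hence the
  assumption \<open>one_iso\<close>.\<close>

locale monoid_iso = monoid M for M :: "('a, 'b) monoid_scheme" +
  fixes N :: "('c, 'd) monoid_scheme" and h
  assumes iso: "h \<in> iso M N" and one_iso: "h \<one>\<^bsub>M\<^esub> = \<one>\<^bsub>N\<^esub>"
begin

lemma hom_h: "h \<in> hom M N"
  and carrier_N: "carrier N = h ` carrier M"
  and inj_h: "inj_on h (carrier M)"
  using iso by (auto simp: iso_def bij_betw_def)

lemma mult_h: "x \<in> carrier M \<Longrightarrow> y \<in> carrier M \<Longrightarrow> h x \<otimes>\<^bsub>N\<^esub> h y = h (x \<otimes>\<^bsub>M\<^esub> y)"
  using hom_mult[OF hom_h] by auto

lemma eq_h_iff: "x \<in> carrier M \<Longrightarrow> y \<in> carrier M \<Longrightarrow> h x = h y \<longleftrightarrow> x = y"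
  using inj_h by (auto dest: inj_onD)

lemma monoid_N: "monoid N"
  using hom_imp_img_monoid[OF hom_h] by (simp add: one_iso flip: carrier_N)

lemma embeds_in_N:
  assumes "embeds_in S M"
  shows "embeds_in S N"
proof -
  obtain f where f: "f \<in> hom S M" "inj_on f (carrier S)"
    using assms by (auto simp: embeds_in_def)
  have "h \<circ> f \<in> hom S N"
    using f hom_h by (auto simp: hom_compose)
  moreover have "inj_on (h \<circ> f) (carrier S)"
    using f inj_h by (intro comp_inj_on) (auto simp: hom_def Pi_iff intro: inj_on_subset)
  ultimately show ?thesis
    by (auto simp: embeds_in_def)
qed

lemma idempotents_N: "idempotents N = h ` idempotents M"
  by (auto simp: idempotents_def carrier_N mult_h eq_h_iff)

lemma submonoid_idempotents_N:
  assumes "submonoid (idempotents M) M"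
  shows "submonoid (idempotents N) N"
proof -
  interpret E: submonoid "idempotents M" M by fact
  show ?thesis
    unfolding idempotents_N
    by unfold_locales (use E.subset in \<open>auto simp: carrier_N mult_h subset_iff simp flip: one_iso\<close>)
qed

lemma semigroup_generate_N:
  assumes "A \<subseteq> carrier M"
  shows "semigroup_generate N (h ` A) = h ` semigroup_generate M A"
proof -
  have closed: "x \<in> carrier M" if "x \<in> semigroup_generate M A" for x
    using that assms by induction auto
  have "x \<in> h ` semigroup_generate M A" if "x \<in> semigroup_generate N (h ` A)" for x
    using that
  proof induction
    case (incl x)
    then show ?case by (auto intro: semigroup_generate.incl)
  next
    case (mult x y)
    then obtain u v where "u \<in> semigroup_generate M A" "v \<in> semigroup_generate M A" "x = h u" "y = h v"
      by blast
    then show ?case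
      using semigroup_generate.mult[of u M A v] by (simp add: mult_h closed)
  qed
  moreover have "h x \<in> semigroup_generate N (h ` A)" if "x \<in> semigroup_generate M A" for x
    using that
  proof induction
    case (incl x)
    then show ?case by (auto intro: semigroup_generate.incl)
  next
    case (mult x y)
    then show ?case
      using semigroup_generate.mult[of "h x" N "h ` A" "h y"] by (simp add: mult_h closed)
  qed
  ultimately show ?thesis by blast
qed

lemma group_element_N:
  assumes "group_element M x"
  shows "group_element N (h x)"
proof -
  obtain H e where H: "H \<subseteq> carrier M" "x \<in> H" "group (M\<lparr>carrier := H, one := e\<rparr>)"
    using assms by (auto simp: group_element_def)
  have "h \<in> hom (M\<lparr>carrier := H, one := e\<rparr>) N"
    using H hom_h by (auto simp: hom_def Pi_iff subset_iff)
  from group.hom_imp_img_group[OF H(3) this]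
  have "group (N\<lparr>carrier := h ` H, one := h e\<rparr>)" by simp
  then show ?thesis
    unfolding group_element_def carrier_N using H
    by (intro exI[of _ "h ` H"] exI[of _ "h e"]) auto
qed

lemma nilpotent_index2_N:
  assumes "nilpotent_index2 M x"
  shows "nilpotent_index2 N (h x)"
proof -
  obtain z where z: "x \<in> carrier M" "is_zero M z" "x \<noteq> z" "x \<otimes>\<^bsub>M\<^esub> x = z"
    using assms by (auto simp: nilpotent_index2_def)
  have "is_zero N (h z)"
    using z by (auto simp: is_zero_def carrier_N mult_h)
  moreover have "h x \<noteq> h z"
    using z by (simp add: eq_h_iff is_zero_def)
  ultimately show ?thesis
    using z by (auto simp: nilpotent_index2_def carrier_N mult_h)
qed

lemma generated_N:
  assumes "generated_by_nilpotent_and_group_element M"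
  shows "generated_by_nilpotent_and_group_element N"
proof -
  obtain a b where ab: "a \<in> carrier M" "b \<in> carrier M" "a \<noteq> b"
    "semigroup_generate M {a, b} = carrier M" "group_element M b" "nilpotent_index2 M a"
    using assms by (auto simp: generated_by_nilpotent_and_group_element_def)
  have "semigroup_generate N {h a, h b} = carrier N"
    using semigroup_generate_N[of "{a, b}"] ab by (simp add: carrier_N)
  moreover have "h a \<in> carrier N" "h b \<in> carrier N" "h a \<noteq> h b"
    using ab by (auto simp: carrier_N eq_h_iff)
  ultimately show ?thesis
    unfolding generated_by_nilpotent_and_group_element_def
    using group_element_N[OF ab(5)] nilpotent_index2_N[OF ab(6)] by (intro exI conjI)
qed

text \<open>Both \<open>h\<close> and its inverse restrict to embeddings between the two sets of
  idempotents, so identities pass in either direction.\<close>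

lemma same_identities_N:
  assumes "submonoid (idempotents M) M"
  shows "same_identities (N\<lparr>carrier := idempotents N\<rparr>) (M\<lparr>carrier := idempotents M\<rparr>)"
proof -
  interpret E: submonoid "idempotents M" M by fact
  interpret F: submonoid "idempotents N" N by (rule submonoid_idempotents_N) fact
  let ?E = "M\<lparr>carrier := idempotents M\<rparr>" and ?F = "N\<lparr>carrier := idempotents N\<rparr>"
  let ?g = "inv_into (carrier M) h"
  have E: "x \<in> carrier M" if "x \<in> idempotents M" for x
    using that E.subset by blast
  have h: "h \<in> hom ?E ?F" "inj_on h (carrier ?E)"
    using inj_h E by (auto simp: hom_def idempotents_N mult_h inj_on_def)
  have g: "?g \<in> hom ?F ?E" "inj_on ?g (carrier ?F)"
    using inj_h E by (auto simp: hom_def idempotents_N mult_h inj_on_def)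
  have "satisfies_identity ?F p q \<longleftrightarrow> satisfies_identity ?E p q"
    if "p \<noteq> []" "q \<noteq> []" for p q
  proof
    show "satisfies_identity ?E p q" if "satisfies_identity ?F p q"
      by (rule satisfies_identity_embedding[OF _ h]) (use \<open>p \<noteq> []\<close> \<open>q \<noteq> []\<close> that in auto)
    show "satisfies_identity ?F p q" if "satisfies_identity ?E p q"
      by (rule satisfies_identity_embedding[OF _ g]) (use \<open>p \<noteq> []\<close> \<open>q \<noteq> []\<close> that in auto)
  qed
  then show ?thesis by (simp add: same_identities_def)
qed

end

lemma ex_nat_monoid_iso:
  fixes M :: "('a, 'b) monoid_scheme"
  assumes M: "monoid M" and fin: "finite (carrier M)"
  obtains N :: "nat monoid" and h where "monoid_iso M N h" "finite (carrier N)"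
proof -
  interpret monoid M by fact
  obtain h :: "'a \<Rightarrow> nat" where h: "inj_on h (carrier M)"
    using finite_imp_inj_to_nat_seg[OF fin] by blast
  let ?g = "inv_into (carrier M) h"
  \<comment> \<open>The product is pulled back along the inverse of an arbitrary injection into the
    natural numbers.\<close>
  define N where "N = \<lparr>carrier = h ` carrier M, mult = \<lambda>x y. h (?g x \<otimes>\<^bsub>M\<^esub> ?g y), one = h \<one>\<^bsub>M\<^esub>\<rparr>"
  have "monoid_iso M N h"
    by unfold_locales (auto simp: N_def iso_def hom_def bij_betw_def h)
  then show ?thesis
    using that fin by (simp add: N_def)
qed

section \<open>Monomial matrices\<close>

text \<open>
  A matrix \<open>f\<close> is encoded by its rows: \<open>f i = Some (j, s)\<close> if \<open>s\<close> is the unique nonzero entry of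
  row \<open>i\<close>, in column \<open>j\<close>, and \<open>f i = None\<close> if row \<open>i\<close> is zero.
\<close>

definition monomial_monoid ::
    "nat \<Rightarrow> ('a, 'b) monoid_scheme \<Rightarrow> (nat \<Rightarrow> (nat \<times> 'a) option) monoid"
  where "monomial_monoid n S =
    \<lparr>carrier = {f. (\<forall>i j s. f i = Some (j, s) \<longrightarrow> i < n \<and> j < n \<and> s \<in> carrier S) \<and>
        (\<forall>i i' j s s'. f i = Some (j, s) \<longrightarrow> f i' = Some (j, s') \<longrightarrow> i = i')},
     mult = \<lambda>f g i. case f i of None \<Rightarrow> None
        | Some (j, s) \<Rightarrow> map_option (\<lambda>(k, t). (k, s \<otimes>\<^bsub>S\<^esub> t)) (g j),
     one = \<lambda>i. if i < n then Some (i, \<one>\<^bsub>S\<^esub>) else None\<rparr>"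

context monoid
begin

abbreviation "PMon n \<equiv> monomial_monoid n G"

lemma PMon_mult_apply:
  "(f \<otimes>\<^bsub>PMon n\<^esub> g) i = (case f i of None \<Rightarrow> None
    | Some (j, s) \<Rightarrow> map_option (\<lambda>(k, t). (k, s \<otimes> t)) (g j))"
  by (simp add: monomial_monoid_def)

lemma PMon_mult_eq_Some_iff:
  "(f \<otimes>\<^bsub>PMon n\<^esub> g) i = Some (k, u) \<longleftrightarrow>
    (\<exists>j s t. f i = Some (j, s) \<and> g j = Some (k, t) \<and> u = s \<otimes> t)"
  by (auto simp: PMon_mult_apply split: option.splits)

lemma PMon_carrier_iff:
  "f \<in> carrier (PMon n) \<longleftrightarrow>
    (\<forall>i j s. f i = Some (j, s) \<longrightarrow> i < n \<and> j < n \<and> s \<in> carrier G) \<and>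
    (\<forall>i i' j s s'. f i = Some (j, s) \<longrightarrow> f i' = Some (j, s') \<longrightarrow> i = i')"
  by (simp add: monomial_monoid_def)

lemma PMon_one_apply: "\<one>\<^bsub>PMon n\<^esub> i = (if i < n then Some (i, \<one>) else None)"
  by (simp add: monomial_monoid_def)

lemma monoid_PMon: "monoid (PMon n)"
proof (rule monoidI)
  fix f g assume fg: "f \<in> carrier (PMon n)" "g \<in> carrier (PMon n)"
  show "f \<otimes>\<^bsub>PMon n\<^esub> g \<in> carrier (PMon n)"
    using fg unfolding PMon_carrier_iff PMon_mult_eq_Some_iff by (metis m_closed)
  fix k assume k: "k \<in> carrier (PMon n)"
  show "f \<otimes>\<^bsub>PMon n\<^esub> g \<otimes>\<^bsub>PMon n\<^esub> k = f \<otimes>\<^bsub>PMon n\<^esub> (g \<otimes>\<^bsub>PMon n\<^esub> k)"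
    using fg k
    by (intro ext)
      (auto simp: PMon_mult_apply PMon_carrier_iff m_assoc option.map_comp o_def split: option.splits
        intro!: option.map_cong)
next
  show "\<one>\<^bsub>PMon n\<^esub> \<in> carrier (PMon n)"
    by (auto simp: PMon_carrier_iff PMon_one_apply split: if_splits)
next
  fix f assume f: "f \<in> carrier (PMon n)"
  show "\<one>\<^bsub>PMon n\<^esub> \<otimes>\<^bsub>PMon n\<^esub> f = f"
  proof (rule ext)
    fix i show "(\<one>\<^bsub>PMon n\<^esub> \<otimes>\<^bsub>PMon n\<^esub> f) i = f i"
      using f by (cases "f i") (auto simp: PMon_mult_apply PMon_one_apply PMon_carrier_iff)
  qed
  show "f \<otimes>\<^bsub>PMon n\<^esub> \<one>\<^bsub>PMon n\<^esub> = f"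
    using f
    by (intro ext)
      (auto simp: PMon_mult_apply PMon_one_apply PMon_carrier_iff split: option.splits)
qed

lemma finite_PMon:
  assumes "finite (carrier G)"
  shows "finite (carrier (PMon n))"
proof (rule finite_subset)
  let ?B = "insert None (Some ` ({..<n} \<times> carrier G))"
  show "carrier (PMon n) \<subseteq> {f. \<forall>i. (i \<in> {..<n} \<longrightarrow> f i \<in> ?B) \<and> (i \<notin> {..<n} \<longrightarrow> f i = None)}"
    by (fastforce simp: PMon_carrier_iff image_iff)
  show "finite {f. \<forall>i. (i \<in> {..<n} \<longrightarrow> f i \<in> ?B) \<and> (i \<notin> {..<n} \<longrightarrow> f i = None)}"
    by (rule finite_set_of_finite_funs) (use assms in auto)
qed

section \<open>Idempotent matrices and the identities they satisfy\<close>

lemma idempotent_PMon_diagonal: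
  assumes "f \<in> idempotents (PMon n)" and "f i = Some (j, s)"
  shows "j = i" and "s \<in> idempotents G"
proof -
  have f: "f \<in> carrier (PMon n)" and "f \<otimes>\<^bsub>PMon n\<^esub> f = f"
    using assms(1) by (auto simp: idempotents_def)
  then have "(f \<otimes>\<^bsub>PMon n\<^esub> f) i = Some (j, s)"
    using assms(2) by simp
  \<comment> \<open>Idempotency puts a nonzero entry at \<open>(j, j)\<close>. Column
    \<open>j\<close> has only one nonzero entry, so \<open>i = j\<close>, and then
    \<open>t = s\<close>.\<close>
  then obtain t where t: "f j = Some (j, t)" "s = s \<otimes> t"
    using assms(2) unfolding PMon_mult_eq_Some_iff by auto
  then show "j = i"
    using f assms(2) unfolding PMon_carrier_iff by blast
  then show "s \<in> idempotents G"
    using f t assms(2) by (auto simp: idempotents_def PMon_carrier_iff)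
qed

text \<open>Idempotent matrices are diagonal, so they multiply entry by entry, and a nonzero entry
  of the product is a product of two idempotents of \<open>G\<close>.\<close>

lemma idempotents_PMon_mult_closed:
  assumes closed: "\<And>x y. x \<in> idempotents G \<Longrightarrow> y \<in> idempotents G \<Longrightarrow> x \<otimes> y \<in> idempotents G"
    and f: "f \<in> idempotents (PMon n)" and g: "g \<in> idempotents (PMon n)"
  shows "f \<otimes>\<^bsub>PMon n\<^esub> g \<in> idempotents (PMon n)"
proof -
  interpret M: monoid "PMon n" by (rule monoid_PMon)
  define h where "h = f \<otimes>\<^bsub>PMon n\<^esub> g"
  have "(h \<otimes>\<^bsub>PMon n\<^esub> h) i = h i" for i
  proof (cases "h i")
    case None
    then show ?thesis by (simp add: PMon_mult_apply[of n h])
  next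
    case (Some p)
    obtain k u where p: "p = (k, u)" by force
    then obtain j s t where st: "f i = Some (j, s)" "g j = Some (k, t)" "u = s \<otimes> t"
      using Some unfolding h_def PMon_mult_eq_Some_iff p by blast
    then have "k = i" "u \<in> idempotents G"
      using idempotent_PMon_diagonal[OF f st(1)] idempotent_PMon_diagonal[OF g st(2)] st(3) closed by auto
    then show ?thesis
      using Some p by (simp add: PMon_mult_apply[of n h] idempotents_def)
  qed
  then show ?thesis
    using f g by (auto simp: idempotents_def h_def)
qed

text \<open>At each diagonal position the word is evaluated in \<open>G\<close> with a zero
  adjoined, the zero being \<open>None\<close>.\<close>

lemma word_value_idempotents_PMon:
  assumes "\<And>v. s v \<in> idempotents (PMon n)" and "w \<noteq> []"
  shows "word_value (PMon n) s w i =
    (if \<exists>v\<in>set w. s v i = None then None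
     else Some (i, word_value G (\<lambda>v. case s v i of None \<Rightarrow> \<one> | Some (j, x) \<Rightarrow> x) w))"
  using assms(2)
proof (induction w rule: induct_list012)
  case (2 v)
  then show ?case
    using idempotent_PMon_diagonal[OF assms(1)[of v], of i] by (auto split: option.splits)
next
  case (3 v u ws)
  have IH: "word_value (PMon n) s (u # ws) i =
    (if \<exists>v\<in>set (u # ws). s v i = None then None
     else Some (i, word_value G (\<lambda>v. case s v i of None \<Rightarrow> \<one> | Some (j, x) \<Rightarrow> x) (u # ws)))"
    using 3 by blast
  show ?case
  proof (cases "s v i")
    case None
    then show ?thesis by (simp add: PMon_mult_apply)
  next
    case (Some p)
    then obtain x where "s v i = Some (i, x)"
      using idempotent_PMon_diagonal[OF assms(1)[of v], of i] by (cases p) auto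
    then show ?thesis
      using IH by (simp del: not_None_eq add: PMon_mult_apply)
  qed
qed simp

lemma satisfies_identity_idempotents_PMon:
  assumes sat: "satisfies_identity (G\<lparr>carrier := idempotents G\<rparr>) p q" and "set p = set q"
    and "p \<noteq> []" "q \<noteq> []"
  shows "satisfies_identity (PMon n\<lparr>carrier := idempotents (PMon n)\<rparr>) p q"
  unfolding satisfies_identity_def word_value_carrier_update
proof (intro allI impI ext)
  fix s :: "nat \<Rightarrow> nat \<Rightarrow> (nat \<times> 'a) option" and i
  assume "\<forall>v. s v \<in> carrier (PMon n\<lparr>carrier := idempotents (PMon n)\<rparr>)"
  then have s: "s v \<in> idempotents (PMon n)" for v by simp
  \<comment> \<open>The default \<open>\<one>\<close> is idempotent, so the substitution stays in
    \<open>idempotents G\<close> even for variables whose row \<open>i\<close> is zero. Equal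
    content makes the zero case occur on both sides at once.\<close>
  let ?d = "\<lambda>v. case s v i of None \<Rightarrow> \<one> | Some (j, x) \<Rightarrow> x"
  have "?d v \<in> idempotents G" for v
    using idempotent_PMon_diagonal[OF s[of v], of i]
    by (auto simp: idempotents_def split: option.splits)
  then have "word_value G ?d p = word_value G ?d q"
    using sat by (simp add: satisfies_identity_def)
  then show "word_value (PMon n) s p i = word_value (PMon n) s q i"
    using assms s by (simp del: not_None_eq add: word_value_idempotents_PMon)
qed

subsection \<open>Shifts and matrix units\<close>

text \<open>The \<open>a\<close>-th power of the permutation matrix of the cyclic shift.\<close>

definition shift :: "nat \<Rightarrow> nat \<Rightarrow> nat \<Rightarrow> (nat \<times> 'a) option"
  where "shift n a i = (if i < n then Some ((i + a) mod n, \<one>) else None)"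

definition munit :: "nat \<Rightarrow> 'a \<Rightarrow> nat \<Rightarrow> nat \<Rightarrow> (nat \<times> 'a) option"
  where "munit i s j = (\<lambda>k. if k = i then Some (j, s) else None)"

lemma shift_closed:
  assumes "n > 0"
  shows "shift n a \<in> carrier (PMon n)"
proof -
  have inj: "i = i'" if "i < n" "i' < n" "(i + a) mod n = (i' + a) mod n" for i i'
  proof -
    have "i mod n = i' mod n"
      using that(3) unfolding nat_mod_eq_iff by auto
    then show ?thesis using that by simp
  qed
  show ?thesis
    using assms unfolding PMon_carrier_iff shift_def
    by (auto split: if_splits intro: inj)
qed

lemma shift_mult_shift: "shift n a \<otimes>\<^bsub>PMon n\<^esub> shift n b = shift n (a + b)"
  by (rule ext) (auto simp: PMon_mult_apply shift_def mod_simps add.assoc)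

lemma shift_mod: "shift n (a mod n) = shift n a"
  by (rule ext) (simp add: shift_def mod_simps)

lemma shift_in_semigroup_generate:
  assumes "n > 0" and "shift n 1 \<in> A"
  shows "shift n a \<in> semigroup_generate (PMon n) A"
proof -
  have pos: "shift n (Suc a) \<in> semigroup_generate (PMon n) A" for a
  proof (induction a)
    case 0
    then show ?case using assms by (auto intro: semigroup_generate.incl)
  next
    case (Suc a)
    then show ?case
      using semigroup_generate.mult[OF Suc semigroup_generate.incl[OF assms(2)]]
      by (simp add: shift_mult_shift)
  qed
  \<comment> \<open>A semigroup contains only the positive powers of its generators; adding the
    period \<open>n\<close> makes the exponent positive, which covers \<open>a = 0\<close>.\<close>
  have "shift n a = shift n (Suc (a + n - 1))"
    using assms(1) shift_mod[of n a] shift_mod[of n "a + n"] by simp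
  then show ?thesis using pos by metis
qed

text \<open>The shifts form a cyclic group. \<open>G'\<close> stands for any semigroup with the
  matrix product that contains them, such as the generated one.\<close>

lemma group_element_shift:
  assumes "n > 0"
    and G': "carrier G' \<supseteq> range (shift n)" "mult G' = mult (PMon n)"
  shows "group_element G' (shift n a)"
proof -
  have "group (G'\<lparr>carrier := range (shift n), one := shift n 0\<rparr>)"
  proof (rule groupI)
    fix x assume "x \<in> carrier (G'\<lparr>carrier := range (shift n), one := shift n 0\<rparr>)"
    then obtain b where b: "x = shift n b" by auto
    have "shift n (n - b mod n) \<otimes>\<^bsub>PMon n\<^esub> shift n (b mod n) = shift n 0"
      using assms(1) shift_mod[of n n] by (simp add: shift_mult_shift less_imp_le)
    then show "\<exists>y\<in>carrier (G'\<lparr>carrier := range (shift n), one := shift n 0\<rparr>).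
        y \<otimes>\<^bsub>G'\<lparr>carrier := range (shift n), one := shift n 0\<rparr>\<^esub> x
        = \<one>\<^bsub>G'\<lparr>carrier := range (shift n), one := shift n 0\<rparr>\<^esub>"
      using b by (auto simp: G' shift_mod)
  qed (auto simp: G' shift_mult_shift add.assoc)
  then show ?thesis
    using G'(1) unfolding group_element_def by blast
qed

text \<open>The matrix \<open>\<alpha>\<close>, for an enumeration \<open>c\<close> of the monoid.\<close>

definition spread :: "nat \<Rightarrow> (nat \<Rightarrow> 'a) \<Rightarrow> nat \<Rightarrow> (nat \<times> 'a) option"
  where "spread m c i = (if i < m then Some (m * (i + 1), c i) else None)"

text \<open>The last nonzero row \<open>m - 1\<close> has its entry in column \<open>m * m\<close>,
  so the size must exceed \<open>m * m\<close>.\<close>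

lemma spread_closed:
  assumes "c ` {..<m} \<subseteq> carrier G"
  shows "spread m c \<in> carrier (PMon (m * m + 1))"
proof -
  have "m * (i + 1) < m * m + 1" "i < m * m + 1" if "i < m" for i
  proof -
    have "m * (i + 1) \<le> m * m" using that by (intro mult_le_mono) auto
    then show "m * (i + 1) < m * m + 1" by simp
    have "i < m * m" using that by (cases m) auto
    then show "i < m * m + 1" by simp
  qed
  then show ?thesis
    using assms by (auto simp: PMon_carrier_iff spread_def split: if_splits)
qed

text \<open>Nonzero rows have index below \<open>m\<close>, nonzero columns have index at least
  \<open>m\<close>.\<close>

lemma spread_square: "spread m c \<otimes>\<^bsub>PMon n\<^esub> spread m c = (\<lambda>_. None)"
  by (rule ext) (simp add: PMon_mult_apply spread_def)

text \<open>The shift moves column \<open>m * (i + 1)\<close> to \<open>m * (i - k)\<close> modulo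
  \<open>n\<close>. This is a nonzero row of the second factor only for \<open>i = k\<close>, where
  it is row 0, with entry \<open>c 0 = \<one>\<close> in column \<open>m\<close>.\<close>

lemma spread_shift_spread:
  assumes k: "k < m" and c: "c ` {..<m} \<subseteq> carrier G" "c 0 = \<one>"
  defines "n \<equiv> m * m + 1"
  shows "spread m c \<otimes>\<^bsub>PMon n\<^esub> shift n (n - m * (k + 1)) \<otimes>\<^bsub>PMon n\<^esub> spread m c = munit k (c k) m"
proof (rule ext)
  fix i
  have less: "m * (j + 1) < n" if "j < m" for j
  proof -
    have "m * (j + 1) \<le> m * m" using that by (intro mult_le_mono) auto
    then show ?thesis by (simp add: n_def)
  qed
  have hit: "(m * (i + 1) + (n - m * (k + 1))) mod n < m \<longleftrightarrow> i = k" if i: "i < m"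
  proof -
    consider "i = k" | "i < k" | "k < i" by linarith
    then show ?thesis
    proof cases
      case 1
      then show ?thesis using less[OF k] k by simp
    next
      case 2
      then obtain d where d: "k = i + d" "d > 0" using less_imp_add_positive by auto
      have "m * d + m \<le> m * m" using mult_le_mono2[of "d + 1" m m] d k by simp
      moreover have "m * (i + 1) + (n - m * (k + 1)) = n - m * d"
        using less[OF k] d by (simp add: algebra_simps)
      \<comment> \<open>Thus \<open>n - m * d\<close> is below \<open>n\<close>, hence already
        reduced, and by the first bound it is greater than \<open>m\<close>.\<close>
      moreover have "m * d > 0" using k d by simp
      ultimately show ?thesis using 2 by (simp add: n_def)
    next
      case 3
      then obtain d where d: "i = k + d" "d > 0" using less_imp_add_positive by auto
      have eq: "m * (i + 1) + (n - m * (k + 1)) = m * d + n"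
        using less[OF k] d by (simp add: algebra_simps)
      have "m * d < n" using less[OF i] d by (simp add: algebra_simps)
      moreover have "m * d \<ge> m" using d by simp
      ultimately show ?thesis unfolding eq using 3 d(2) by simp
    qed
  qed
  show "(spread m c \<otimes>\<^bsub>PMon n\<^esub> shift n (n - m * (k + 1)) \<otimes>\<^bsub>PMon n\<^esub> spread m c) i = munit k (c k) m i"
  proof (cases "i < m")
    case True
    show ?thesis
    proof (cases "i = k")
      case True
      \<comment> \<open>Allows the factors \<open>\<one>\<close> from the shift and from
        \<open>c 0\<close> to be cancelled.\<close>
      have "c k \<in> carrier G" using c k by auto
      moreover have "(m * (k + 1) + (n - m * (k + 1))) mod n = 0" using less[OF k] by simp
      ultimately show ?thesis
        using True k c less[OF k]
        by (simp del: mult_Suc_right add_Suc_right add: PMon_mult_apply spread_def shift_def munit_def)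
    next
      case False
      then show ?thesis
        using True hit[OF True] less[OF True]
        by (simp del: mult_Suc_right add_Suc_right add: PMon_mult_apply spread_def shift_def munit_def)
    qed
  next
    case False
    then show ?thesis
      using k by (simp add: PMon_mult_apply spread_def munit_def)
  qed
qed

text \<open>The left factor moves row \<open>i\<close> to row 0, the right factor moves column
  \<open>j\<close> to column \<open>n\<close>, that is, to 0 modulo \<open>n\<close>.\<close>

lemma shift_munit_shift:
  assumes "i < n" "j < n" "s \<in> carrier G"
  shows "shift n i \<otimes>\<^bsub>PMon n\<^esub> munit i s j \<otimes>\<^bsub>PMon n\<^esub> shift n (n - j) = munit 0 s 0"
proof (rule ext)
  fix k
  have "(k + i) mod n = i \<longleftrightarrow> k = 0" if "k < n"
    using that assms(1) by (cases "k + i < n") (auto simp: le_mod_geq)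
  then show "(shift n i \<otimes>\<^bsub>PMon n\<^esub> munit i s j \<otimes>\<^bsub>PMon n\<^esub> shift n (n - j)) k = munit 0 s 0 k"
    using assms by (auto simp: PMon_mult_apply shift_def munit_def)
qed

lemma munit_in_semigroup_generate:
  assumes c: "c ` {..<m} = carrier G" "c 0 = \<one>" and s: "s \<in> carrier G"
  defines "n \<equiv> m * m + 1"
  shows "munit 0 s 0 \<in> semigroup_generate (PMon n) {spread m c, shift n 1}"
    (is "_ \<in> ?gen")
proof -
  obtain k where k: "k < m" "s = c k" using c s by auto
  have "m \<le> m * m" by (cases m) auto
  then have "k < n" "m < n" using k unfolding n_def by linarith+
  have a: "spread m c \<in> ?gen" and b: "shift n l \<in> ?gen" for l
    by (auto intro: semigroup_generate.incl shift_in_semigroup_generate simp: n_def)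
  have "munit k s m \<in> ?gen"
    using spread_shift_spread[OF k(1), of c] c k a b
    by (metis n_def order_refl semigroup_generate.mult)
  then show ?thesis
    using shift_munit_shift[OF \<open>k < n\<close> \<open>m < n\<close> s] b by (metis semigroup_generate.mult)
qed

section \<open>The embedding\<close>

text \<open>\<open>T\<close> is the subsemigroup of matrices generated by \<open>\<alpha>\<close>
  and \<open>\<beta>\<close>. It contains the identity as a power of \<open>\<beta>\<close>, the
  zero as the square of \<open>\<alpha>\<close>, and a copy of \<open>G\<close> at position
  \<open>(0, 0)\<close>.\<close>

lemma ex_generated_overmonoid:
  assumes fin: "finite (carrier G)" and sub: "subsemigroup (idempotents G) G"
  shows "\<exists>T :: (nat \<Rightarrow> (nat \<times> 'a) option) monoid.
    monoid T \<and> finite (carrier T) \<and> embeds_in G T \<and> submonoid (idempotents T) T \<and>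
    generated_by_nilpotent_and_group_element T \<and>
    (card (idempotents G) \<ge> 2 \<longrightarrow>
      same_identities (T\<lparr>carrier := idempotents T\<rparr>) (G\<lparr>carrier := idempotents G\<rparr>))"
proof -
  have E_closed: "x \<otimes> y \<in> idempotents G" if "x \<in> idempotents G" "y \<in> idempotents G" for x y
    using sub that by (auto simp: subsemigroup_def)
  define m where "m = card (carrier G)"
  have m: "m > 0" using fin one_closed by (auto simp: m_def card_gt_0_iff)
  obtain c where c: "bij_betw c {..<m} (carrier G)" "c 0 = \<one>"
  proof -
    obtain d where d: "bij_betw d {..<m} (carrier G)"
      using ex_bij_betw_nat_finite[OF fin] by (auto simp: m_def atLeast0LessThan)
    then obtain k where k: "k < m" "d k = \<one>"
      using one_closed unfolding bij_betw_def by (metis imageE lessThan_iff)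
    \<comment> \<open>Swapping 0 and \<open>k\<close> moves the identity of \<open>G\<close> to the
      front of the enumeration.\<close>
    have "bij_betw (id(0 := k, k := 0)) {..<m} {..<m}"
      using k m by (intro bij_betw_byWitness[where f' = "id(0 := k, k := 0)"]) auto
    from bij_betw_trans[OF this d] k show ?thesis
      by (intro that[of "d \<circ> id(0 := k, k := 0)"]) auto
  qed
  then have c_img: "c ` {..<m} = carrier G" by (auto simp: bij_betw_def)
  define n where "n = m * m + 1"
  interpret M: monoid "PMon n" by (rule monoid_PMon)
  define \<alpha> where "\<alpha> = spread m c"
  define \<beta> where "\<beta> = shift n 1"
  define gen where "gen = semigroup_generate (PMon n) {\<alpha>, \<beta>}"
  define T where "T = PMon n\<lparr>carrier := gen\<rparr>"
  have mult_T [simp]: "mult T = mult (PMon n)" and carrier_T [simp]: "carrier T = gen"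
    and one_T [simp]: "\<one>\<^bsub>T\<^esub> = \<one>\<^bsub>PMon n\<^esub>"
    by (simp_all add: T_def)
  have \<alpha>\<beta>: "\<alpha> \<in> carrier (PMon n)" "\<beta> \<in> carrier (PMon n)"
    using spread_closed[of c m] c_img shift_closed[of n 1] by (auto simp: \<alpha>_def \<beta>_def n_def)
  have "x \<in> carrier (PMon n)" if "x \<in> gen" for x
    using that unfolding gen_def by induction (use \<alpha>\<beta> in auto)
  then have gen_sub: "gen \<subseteq> carrier (PMon n)" by blast
  have gen_mult: "x \<otimes>\<^bsub>PMon n\<^esub> y \<in> gen" if "x \<in> gen" "y \<in> gen" for x y
    using that unfolding gen_def by (rule semigroup_generate.mult)
  have \<alpha>: "\<alpha> \<in> gen" by (auto simp: gen_def intro: semigroup_generate.incl)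
  have shifts: "shift n a \<in> gen" for a
    unfolding gen_def by (rule shift_in_semigroup_generate) (auto simp: n_def \<beta>_def)
  have "\<one>\<^bsub>PMon n\<^esub> = shift n 0" by (rule ext) (simp add: PMon_one_apply shift_def)
  then have "submonoid gen (PMon n)"
    using gen_sub gen_mult shifts[of 0] by unfold_locales auto
  then have "monoid T"
    unfolding T_def by (rule submonoid.submonoid_is_monoid) (rule M.monoid_axioms)
  moreover have "finite (carrier T)"
    using gen_sub finite_PMon[OF fin] by (auto intro: finite_subset)
  moreover
  \<comment> \<open>As \<open>n\<close> is at least 2, \<open>h\<close> sends \<open>\<one>\<close>
    to an idempotent other than the identity matrix.\<close>
  define h where "h s = munit 0 s 0" for s
  have h: "h \<in> hom G T" "inj_on h (carrier G)"
  proof -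
    have "h s \<in> gen" if "s \<in> carrier G" for s
      using munit_in_semigroup_generate[OF c_img c(2) that]
      by (simp add: gen_def \<alpha>_def \<beta>_def n_def h_def)
    moreover have "h (s \<otimes> t) = h s \<otimes>\<^bsub>PMon n\<^esub> h t" for s t
      by (rule ext) (simp add: PMon_mult_apply h_def munit_def)
    ultimately show "h \<in> hom G T" by (auto simp: hom_def)
    show "inj_on h (carrier G)"
      by (rule inj_onI) (metis h_def munit_def option.inject prod.inject)
  qed
  then have "embeds_in G T" by (auto simp: embeds_in_def)
  moreover
  have idem_T: "idempotents T = idempotents (PMon n) \<inter> gen"
    using gen_sub by (auto simp: idempotents_def)
  have idem_T_closed: "x \<otimes>\<^bsub>PMon n\<^esub> y \<in> idempotents T" if "x \<in> idempotents T" "y \<in> idempotents T" for x y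
    using that idempotents_PMon_mult_closed[OF E_closed, of x n y] gen_mult by (auto simp: idem_T)
  have "submonoid (idempotents T) T"
  proof
    show "\<one>\<^bsub>T\<^esub> \<in> idempotents T"
      using \<open>monoid T\<close> by (auto simp: idempotents_def monoid.one_closed monoid.l_one simp del: mult_T carrier_T one_T)
  qed (use idem_T idem_T_closed in auto)
  moreover have "generated_by_nilpotent_and_group_element T"
    unfolding generated_by_nilpotent_and_group_element_def
  proof (intro exI conjI)
    have "x \<in> gen" if "x \<in> semigroup_generate T {\<alpha>, \<beta>}" for x
      using that by induction (use gen_mult in \<open>auto simp: gen_def intro: semigroup_generate.incl\<close>)
    moreover have "x \<in> semigroup_generate T {\<alpha>, \<beta>}" if "x \<in> gen" for x
      using that unfolding gen_def
    proof induction
      case (mult x y)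
      then show ?case using semigroup_generate.mult[of x T _ y] by simp
    qed (rule semigroup_generate.incl)
    ultimately show "semigroup_generate T {\<alpha>, \<beta>} = carrier T" by auto
    show "group_element T \<beta>"
      unfolding \<beta>_def by (rule group_element_shift) (use shifts in \<open>auto simp: n_def\<close>)
    have "(\<lambda>_. None) \<in> gen"
      using gen_mult[OF \<alpha> \<alpha>] spread_square[of n m c] by (simp add: \<alpha>_def)
    then have "is_zero T (\<lambda>_. None)"
      by (auto simp: is_zero_def PMon_mult_apply fun_eq_iff split: option.splits)
    moreover have "\<alpha> \<noteq> (\<lambda>_. None)"
      using m by (auto simp: \<alpha>_def spread_def fun_eq_iff)
    ultimately show "nilpotent_index2 T \<alpha>"
      using \<alpha> spread_square[of n m c] by (auto simp: nilpotent_index2_def \<alpha>_def)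
    \<comment> \<open>Row \<open>m\<close> exists because \<open>m < n\<close>; it is zero in
      \<open>\<alpha>\<close> but not in the permutation matrix \<open>\<beta>\<close>.\<close>
    have "\<alpha> m = None" "\<beta> m \<noteq> None"
      using m by (auto simp: \<alpha>_def \<beta>_def spread_def shift_def n_def less_Suc_eq_le)
    then show "\<alpha> \<noteq> \<beta>" by auto
  qed (use \<alpha> shifts in \<open>auto simp: \<beta>_def\<close>)
  moreover have "same_identities (T\<lparr>carrier := idempotents T\<rparr>) (G\<lparr>carrier := idempotents G\<rparr>)"
    if "card (idempotents G) \<ge> 2"
    unfolding same_identities_def
  proof (intro allI impI iffI)
    fix p q :: "nat list" assume pq: "p \<noteq> []" "q \<noteq> []"
    show "satisfies_identity (G\<lparr>carrier := idempotents G\<rparr>) p q"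
      if "satisfies_identity (T\<lparr>carrier := idempotents T\<rparr>) p q"
    proof (rule satisfies_identity_embedding[OF _ _ _ pq that])
      show "h \<in> hom (G\<lparr>carrier := idempotents G\<rparr>) (T\<lparr>carrier := idempotents T\<rparr>)"
        using h(1) unfolding hom_def idempotents_def Pi_iff by simp metis
      show "inj_on h (carrier (G\<lparr>carrier := idempotents G\<rparr>))"
        using h(2) by (auto simp: idempotents_def inj_on_def)
    qed (use E_closed in auto)
    \<comment> \<open>Two idempotents give one different from \<open>\<one>\<close>, which forces
      equal content on both sides of the identity.\<close>
    have "idempotents G \<noteq> {\<one>}" "idempotents G \<noteq> {}"
      using that by auto
    then obtain e where e: "e \<in> idempotents G" "e \<noteq> \<one>" by blast
    assume sat: "satisfies_identity (G\<lparr>carrier := idempotents G\<rparr>) p q"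
    \<comment> \<open>The identity is proved for all idempotent matrices and then restricted to
      those in \<open>gen\<close>.\<close>
    have "satisfies_identity (PMon n\<lparr>carrier := idempotents (PMon n)\<rparr>) p q"
      using same_content_if_satisfies_identity[OF monoid_axioms sat e pq]
      by (intro satisfies_identity_idempotents_PMon sat pq)
    then show "satisfies_identity (T\<lparr>carrier := idempotents T\<rparr>) p q"
      by (auto simp: satisfies_identity_def idem_T) (simp add: T_def)
  qed
  ultimately show ?thesis by blast
qed

end

text \<open>A single matrix monoid, copied to the natural numbers, witnesses both existence
  claims.\<close>

theorem corollary3p7:
  fixes S :: "('a, 'b) monoid_scheme"
  assumes "monoid S" and "finite (carrier S)"
    and "subsemigroup (idempotents S) S"
  shows "(\<exists>T :: nat monoid.
            monoid T \<and> finite (carrier T) \<and> embeds_in S T \<and>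
            submonoid (idempotents T) T \<and>
            generated_by_nilpotent_and_group_element T) \<and>
         (card (idempotents S) \<ge> 2 \<longrightarrow>
          (\<exists>T :: nat monoid.
            monoid T \<and> finite (carrier T) \<and> embeds_in S T \<and>
            submonoid (idempotents T) T \<and>
            generated_by_nilpotent_and_group_element T \<and>
            same_identities (T\<lparr>carrier := idempotents T\<rparr>) (S\<lparr>carrier := idempotents S\<rparr>)))"
proof -
  obtain M :: "(nat \<Rightarrow> (nat \<times> 'a) option) monoid" where M: "monoid M" "finite (carrier M)"
    "embeds_in S M" "submonoid (idempotents M) M" "generated_by_nilpotent_and_group_element M"
    "card (idempotents S) \<ge> 2 \<longrightarrow>
      same_identities (M\<lparr>carrier := idempotents M\<rparr>) (S\<lparr>carrier := idempotents S\<rparr>)"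
    using monoid.ex_generated_overmonoid[OF assms] by blast
  obtain T :: "nat monoid" and h where T: "monoid_iso M T h" "finite (carrier T)"
    using ex_nat_monoid_iso[OF M(1,2)] by blast
  interpret monoid_iso M T h by fact
  have "same_identities (T\<lparr>carrier := idempotents T\<rparr>) (S\<lparr>carrier := idempotents S\<rparr>)"
    if "card (idempotents S) \<ge> 2"
    using M(6) that same_identities_N[OF M(4)] unfolding same_identities_def by blast
  moreover note monoid_N T(2) embeds_in_N[OF M(3)] submonoid_idempotents_N[OF M(4)]
    generated_N[OF M(5)]
  ultimately show ?thesis by (intro conjI impI exI[of _ T])
qed

end
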